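(* Let $\mathbb{D}$ be a divergence. Consider a homogeneous Markov chain $\mathcal{N}\colon A\to A$ with fixed point $\omega_A$. Then $$t^{\mathbb{D}}_{\mathrm{rep}}(\mathcal{N},\delta)\leq\frac{\log(C^\Delta_{\mathbb{D}}/\delta)}{\log\!\left(1/\eta^{\Delta,\mathrm{stab}}_{\mathbb{D}}(\mathcal{N},\omega)\right)},$$ where $$C^\Delta_{\mathbb{D}}=\sup_{\rho_{RA},\,\sigma_R}\left[\mathbb{D}(\rho_{RA}\|\sigma_R\otimes\omega_A)-\mathbb{D}(\rho_R\|\sigma_R)\right].$$
   Context: A (quantum) divergence $\mathbb{D}$ is a function mapping two quantum states to a real number and satisfying data processing, $\mathbb{D}(\rho\|\sigma)\geq\mathbb{D}(\mathcal{T}(\rho)\|\mathcal{T}(\sigma))$ for all channels $\mathcal{T}$. A homogeneous Markov chain $\mathcal{N}\colon A\to A$ is the process in which the same quantum channel $\mathcal{N}$ is applied at each time step; $\mathcal{N}^n$ is the $n$-fold composition. For a quantum channel $\mathcal{N}\colon A\to A$ with unique fixed point $\omega$ and $\delta\geq0$, the $\mathbb{D}$-replacement time is $$t^{\mathbb{D}}_{\mathrm{rep}}(\mathcal{N},\delta)=\inf\left\{n\in\mathbb{N}:\ \mathbb{D}((\operatorname{id}_R\otimes\mathcal{N}^n)(\rho_{RA})\|\sigma_R\otimes\omega_A)-\mathbb{D}(\rho_R\|\sigma_R)\leq\delta\ \ \forall R,\ \forall\rho_{RA},\ \forall\sigma_R\right\},$$ with $R$ ranging over reference systems and $\rho_{RA},\sigma_R$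 over quantum states; the supremum in $C^\Delta_{\mathbb{D}}$ is over the same objects. The conditional SDPI constant for a fixed state $\sigma_{RA}$ is $$\eta^\Delta_{\mathbb{D}}(\mathcal{N},\sigma_{RA})=\sup_{\rho_{RA}\neq\sigma_{RA}}\frac{\mathbb{D}((\operatorname{id}\otimes\mathcal{N})(\rho_{RA})\|(\operatorname{id}\otimes\mathcal{N})(\sigma_{RA}))-\mathbb{D}(\rho_R\|\sigma_R)}{\mathbb{D}(\rho_{RA}\|\sigma_{RA})-\mathbb{D}(\rho_R\|\sigma_R)},$$ the optimization being over states for which the denominator is strictly positive and finite (value $0$ if there are none), and $\eta^{\Delta,\mathrm{stab}}_{\mathbb{D}}(\mathcal{N},\omega)=\sup_{S,\tau_S}\eta^\Delta_{\mathbb{D}}(\mathcal{N},\tau_S\otimes\omega_A)$, over all finite-dimensional quantum systems $S$ (serving as the reference system) and states $\tau_S$.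
   Formalization: The replacement time is an integer, so the printed bound fails literally; it is proved with the right side rounded up to the least natural number at least the ratio. If eta = 0 and C is finite, the bound is 0 when C <= delta and 1 otherwise; nothing is claimed for eta = 0, C infinite. *)

theory Defs
  imports "Jordan_Normal_Form.Matrix" "HOL-Library.Extended_Real"
begin

text \<open>A quantum system is represented by its finite dimension \<open>n\<close>, i.e. by the matrix algebra
  \<open>carrier_mat n n\<close>.  A composite system \<open>RA\<close> of dimensions \<open>r\<close> and \<open>d\<close> has dimension \<open>r * d\<close>; the
  basis vector \<open>(i, a)\<close> has index \<open>i * d + a\<close>, so that the tensor product is the Kronecker product.\<close>

definition mat_trace :: "complex mat \<Rightarrow> complex" where
  "mat_trace X = (\<Sum>i<dim_row X. X $$ (i, i))"

text \<open>The order on complex numbers: \<open>0 \<le> z\<close> means that \<open>z\<close> is real and nonnegative.\<close>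

definition psd :: "nat \<Rightarrow> complex mat \<Rightarrow> bool" where
  "psd n X \<longleftrightarrow> X \<in> carrier_mat n n \<and> (\<forall>v\<in>carrier_vec n. 0 \<le> (X *\<^sub>v v) \<bullet>c v)"

definition states :: "nat \<Rightarrow> complex mat set" where
  "states n = {\<rho>. psd n \<rho> \<and> mat_trace \<rho> = 1}"

definition kron :: "complex mat \<Rightarrow> complex mat \<Rightarrow> complex mat" where
  "kron X Y = mat (dim_row X * dim_row Y) (dim_col X * dim_col Y)
     (\<lambda>(p, q). X $$ (p div dim_row Y, q div dim_col Y) * Y $$ (p mod dim_row Y, q mod dim_col Y))"

definition marginal :: "nat \<Rightarrow> nat \<Rightarrow> complex mat \<Rightarrow> complex mat" where
  "marginal r d X = mat r r (\<lambda>(i, j). \<Sum>a<d. X $$ (i * d + a, j * d + a))"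

definition block :: "nat \<Rightarrow> complex mat \<Rightarrow> nat \<Rightarrow> nat \<Rightarrow> complex mat" where
  "block n X i j = mat n n (\<lambda>(a, b). X $$ (i * n + a, j * n + b))"

text \<open>\<open>id \<otimes> T\<close> for \<open>T\<close> from dimension \<open>n\<close> to dimension \<open>m\<close>: apply \<open>T\<close> to each of the \<open>k\<^sup>2\<close> blocks.\<close>

definition id_tensor ::
    "nat \<Rightarrow> nat \<Rightarrow> nat \<Rightarrow> (complex mat \<Rightarrow> complex mat) \<Rightarrow> complex mat \<Rightarrow> complex mat" where
  "id_tensor k n m T X = mat (k * m) (k * m)
     (\<lambda>(p, q). T (block n X (p div m) (q div m)) $$ (p mod m, q mod m))"

definition channel :: "nat \<Rightarrow> nat \<Rightarrow> (complex mat \<Rightarrow> complex mat) \<Rightarrow> bool" where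
  "channel n m T \<longleftrightarrow>
     T \<in> carrier_mat n n \<rightarrow> carrier_mat m m \<and>
     (\<forall>X\<in>carrier_mat n n. \<forall>Y\<in>carrier_mat n n. T (X + Y) = T X + T Y) \<and>
     (\<forall>c. \<forall>X\<in>carrier_mat n n. T (c \<cdot>\<^sub>m X) = c \<cdot>\<^sub>m T X) \<and>
     (\<forall>k X. psd (k * n) X \<longrightarrow> psd (k * m) (id_tensor k n m T X)) \<and>
     (\<forall>X\<in>carrier_mat n n. mat_trace (T X) = mat_trace X)"

definition unique_fixed_state ::
    "nat \<Rightarrow> (complex mat \<Rightarrow> complex mat) \<Rightarrow> complex mat \<Rightarrow> bool" where
  "unique_fixed_state d N \<omega> \<longleftrightarrow>
     \<omega> \<in> states d \<and> N \<omega> = \<omega> \<and> (\<forall>\<omega>'\<in>states d. N \<omega>' = \<omega>' \<longrightarrow> \<omega>' = \<omega>)"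

text \<open>The type \<open>ereal\<close> is used because divergences (e.g. the relative entropy) may take the value
  \<open>\<infinity>\<close>; the value \<open>-\<infinity>\<close> is excluded.\<close>

type_synonym divergence_fun = "complex mat \<Rightarrow> complex mat \<Rightarrow> ereal"

definition divergence :: "divergence_fun \<Rightarrow> bool" where
  "divergence D \<longleftrightarrow>
     (\<forall>n. \<forall>\<rho>\<in>states n. \<forall>\<sigma>\<in>states n. D \<rho> \<sigma> \<noteq> -\<infinity>) \<and>
     (\<forall>n m T. channel n m T \<longrightarrow>
        (\<forall>\<rho>\<in>states n. \<forall>\<sigma>\<in>states n. D (T \<rho>) (T \<sigma>) \<le> D \<rho> \<sigma>))"

text \<open>In the replacement time and in the constant \<open>C\<close>, only pairs with \<open>D \<rho>\<^sub>R \<sigma>\<^sub>R\<close> finite are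
  considered, since otherwise the difference is the undefined expression \<open>\<infinity> - \<infinity>\<close>
  (which \<open>ereal\<close> would evaluate to \<open>\<infinity>\<close>).  The infimum over the empty set is \<open>\<infinity>\<close>.\<close>

definition replacement_time ::
    "divergence_fun \<Rightarrow> nat \<Rightarrow> (complex mat \<Rightarrow> complex mat) \<Rightarrow> real \<Rightarrow> ereal" where
  "replacement_time D d N \<delta> =
     (let \<omega> = (THE \<omega>. unique_fixed_state d N \<omega>) in
      INF n\<in>{n :: nat. \<forall>r. \<forall>\<rho>\<in>states (r * d). \<forall>\<sigma>\<in>states r. D (marginal r d \<rho>) \<sigma> \<noteq> \<infinity> \<longrightarrow>
                D (id_tensor r d d (N ^^ n) \<rho>) (kron \<sigma> \<omega>) - D (marginal r d \<rho>) \<sigma> \<le> ereal \<delta>}.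
        ereal (real n))"

definition C_Delta :: "divergence_fun \<Rightarrow> nat \<Rightarrow> complex mat \<Rightarrow> ereal" where
  "C_Delta D d \<omega> =
     Sup {D \<rho> (kron \<sigma> \<omega>) - D (marginal r d \<rho>) \<sigma> | r \<rho> \<sigma>.
            \<rho> \<in> states (r * d) \<and> \<sigma> \<in> states r \<and> D (marginal r d \<rho>) \<sigma> \<noteq> \<infinity>}"

definition sdpi_ratios ::
    "divergence_fun \<Rightarrow> nat \<Rightarrow> nat \<Rightarrow> (complex mat \<Rightarrow> complex mat) \<Rightarrow> complex mat \<Rightarrow> ereal set" where
  "sdpi_ratios D r d N \<sigma> =
     {(D (id_tensor r d d N \<rho>) (id_tensor r d d N \<sigma>) - D (marginal r d \<rho>) (marginal r d \<sigma>)) /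
        (D \<rho> \<sigma> - D (marginal r d \<rho>) (marginal r d \<sigma>)) | \<rho>.
      \<rho> \<in> states (r * d) \<and> \<rho> \<noteq> \<sigma> \<and>
      0 < D \<rho> \<sigma> - D (marginal r d \<rho>) (marginal r d \<sigma>) \<and>
      D \<rho> \<sigma> - D (marginal r d \<rho>) (marginal r d \<sigma>) < \<infinity>}"

definition eta_Delta ::
    "divergence_fun \<Rightarrow> nat \<Rightarrow> nat \<Rightarrow> (complex mat \<Rightarrow> complex mat) \<Rightarrow> complex mat \<Rightarrow> ereal" where
  "eta_Delta D r d N \<sigma> = (if sdpi_ratios D r d N \<sigma> = {} then 0 else Sup (sdpi_ratios D r d N \<sigma>))"

definition eta_Delta_stab ::
    "divergence_fun \<Rightarrow> nat \<Rightarrow> (complex mat \<Rightarrow> complex mat) \<Rightarrow> complex mat \<Rightarrow> ereal" where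
  "eta_Delta_stab D d N \<omega> = Sup {eta_Delta D s d N (kron \<tau> \<omega>) | s \<tau>. \<tau> \<in> states s}"

definition ln_ereal :: "ereal \<Rightarrow> ereal" where
  "ln_ereal x = (if x \<le> 0 then -\<infinity> else if x = \<infinity> then \<infinity> else ereal (ln (real_of_ereal x)))"

text \<open>The least natural number that is at least \<open>x\<close>, i.e. \<open>max 0 \<lceil>x\<rceil>\<close> (\<open>\<infinity>\<close> for \<open>x = \<infinity>\<close>).\<close>

definition nat_ceiling_ereal :: "ereal \<Rightarrow> ereal" where
  "nat_ceiling_ereal x = (INF n\<in>{n :: nat. x \<le> ereal (real n)}. ereal (real n))"

end

(* The gap \<Delta>(\<rho>, \<sigma>) = D(\<rho>, \<sigma> \<otimes> \<omega>) - D(\<rho>_R, \<sigma>) contracts by the factor \<eta> under id \<otimes> N: this channel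
   fixes \<sigma> \<otimes> \<omega> and preserves the marginal on R, so the image of the gap over the gap is one of the
   SDPI ratios for \<sigma> \<otimes> \<omega>.  Pairs excluded from the ratios have \<Delta> \<le> 0, where data processing
   suffices; for \<rho> = \<sigma> \<otimes> \<omega> this uses data processing for the preparation channel X \<mapsto> X \<otimes> \<omega>.
   Iterating gives \<Delta>(N^n) \<le> \<eta>^n C, which is at most \<delta> once n \<ge> log(C/\<delta>) / log(1/\<eta>). *)
theory Submission
  imports Defs
begin

section \<open>Positive semidefinite kernels on finite index sets and their Gram
  factorization\<close>

definition psd_on :: "'a set \<Rightarrow> ('a \<Rightarrow> 'a \<Rightarrow> complex) \<Rightarrow> bool" where
  "psd_on I s \<longleftrightarrow> (\<forall>c. 0 \<le> (\<Sum>i\<in>I. \<Sum>j\<in>I. s i j * c j * cnj (c i)))"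

text \<open>Kernels on arbitrary index sets, rather than matrices, allow rows and columns to be
  dropped without renumbering. Here a test vector on \<open>J\<close> is padded with zeros.\<close>

lemma psd_on_subset:
  assumes "psd_on I s" "J \<subseteq> I" "finite I"
  shows "psd_on J s"
  unfolding psd_on_def
proof
  fix c :: "'a \<Rightarrow> complex"
  let ?c = "\<lambda>i. if i \<in> J then c i else 0"
  have "0 \<le> (\<Sum>i\<in>I. \<Sum>j\<in>I. s i j * ?c j * cnj (?c i))"
    using assms(1) unfolding psd_on_def by (rule allE[where x = ?c])
  also have "\<dots> = (\<Sum>i\<in>J. \<Sum>j\<in>I. s i j * ?c j * cnj (?c i))"
    by (rule sum.mono_neutral_right) (use assms in auto)
  also have "\<dots> = (\<Sum>i\<in>J. \<Sum>j\<in>J. s i j * ?c j * cnj (?c i))"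
    by (intro sum.cong refl sum.mono_neutral_right) (use assms in auto)
  also have "\<dots> = (\<Sum>i\<in>J. \<Sum>j\<in>J. s i j * c j * cnj (c i))"
    by (intro sum.cong) auto
  finally show "0 \<le> (\<Sum>i\<in>J. \<Sum>j\<in>J. s i j * c j * cnj (c i))" .
qed

lemma psd_on_diag:
  assumes "psd_on I s" "finite I" "i \<in> I"
  shows "0 \<le> s i i"
proof -
  have "psd_on {i} s" by (rule psd_on_subset[OF assms(1)]) (use assms in auto)
  then show ?thesis unfolding psd_on_def by (auto dest: spec[where x="\<lambda>_. 1"])
qed

lemma psd_on_pair:
  assumes "psd_on I s" "finite I" "i \<in> I" "j \<in> I" "i \<noteq> j"
  shows "0 \<le> s i i * a * cnj a + s i j * b * cnj a + s j i * a * cnj b + s j j * b * cnj b"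
proof -
  have "psd_on {i, j} s" by (rule psd_on_subset[OF assms(1)]) (use assms in auto)
  then have "0 \<le> (\<Sum>k\<in>{i,j}. \<Sum>l\<in>{i,j}. s k l * (if l = i then a else b) * cnj (if k = i then a else b))"
    unfolding psd_on_def by (rule allE[where x = "\<lambda>k. if k = i then a else b"])
  then show ?thesis using assms(5) by (simp add: add_ac)
qed

text \<open>A nonnegative complex number is real. Reality of the form at the test vectors (1, 1) and
  (1, i) supported on the pair gives opposite imaginary parts and equal real parts.\<close>

lemma psd_on_hermitian:
  assumes "psd_on I s" "finite I" "i \<in> I" "j \<in> I"
  shows "s j i = cnj (s i j)"
proof (cases "i = j")
  case True
  then show ?thesis using psd_on_diag[OF assms(1,2,3)]
    by (auto simp: less_eq_complex_def complex_eq_iff)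
next
  case False
  note d = psd_on_diag[OF assms(1,2,3)] psd_on_diag[OF assms(1,2,4)]
  from psd_on_pair[OF assms False, of 1 1] psd_on_pair[OF assms False, of 1 \<i>] d
  show ?thesis by (auto simp: less_eq_complex_def complex_eq_iff)
qed

text \<open>With a zero diagonal entry at \<open>j\<close> the form has no quadratic term in the
  coefficient at \<open>j\<close>, so a nonzero \<open>s i j\<close> would drive it below zero. This
  makes a vanishing pivot harmless in the elimination below.\<close>

lemma psd_on_zero_diag:
  assumes "psd_on I s" "finite I" "i \<in> I" "j \<in> I" "s j j = 0"
  shows "s i j = 0"
proof (cases "i = j")
  case False
  have h: "s j i = cnj (s i j)" by (rule psd_on_hermitian[OF assms(1-4)])
  have *: "0 \<le> Re (s i i) - 2 * t * (cmod (s i j))\<^sup>2" for t :: real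
  proof -
    let ?z = "s i j"
    \<comment> \<open>The coefficient at \<open>j\<close> is aligned with the phase of
      \<open>s i j\<close>, so that both cross terms become the same negative real number for
      positive \<open>t\<close>.\<close>
    have "0 \<le> s i i * 1 * cnj 1 + ?z * (- of_real t * cnj ?z) * cnj 1
        + s j i * 1 * cnj (- of_real t * cnj ?z)
        + s j j * (- of_real t * cnj ?z) * cnj (- of_real t * cnj ?z)"
      by (rule psd_on_pair[OF assms(1-4) False])
    also have "\<dots> = s i i - of_real (2 * t) * (?z * cnj ?z)"
      by (simp add: h assms(5))
    also have "?z * cnj ?z = of_real ((cmod ?z)\<^sup>2)"
      by (simp only: complex_norm_square)
    finally show ?thesis by (simp add: less_eq_complex_def)
  qed
  show ?thesis
  proof (rule ccontr)
    assume "s i j \<noteq> 0"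
    then have pos: "(cmod (s i j))\<^sup>2 \<noteq> 0" by simp
    \<comment> \<open>This value of \<open>t\<close> is chosen so that the lower bound
      \<open>*\<close> reads \<open>0 \<le> -1\<close>.\<close>
    have "2 * ((Re (s i i) + 1) / (2 * (cmod (s i j))\<^sup>2)) * (cmod (s i j))\<^sup>2 = Re (s i i) + 1"
      using pos by simp
    then show False using *[of "(Re (s i i) + 1) / (2 * (cmod (s i j))\<^sup>2)"] by linarith
  qed
qed (use assms in simp)

text \<open>The form of the Schur complement at \<open>c\<close> is the full form at an extension of
  \<open>c\<close> whose entry at \<open>x\<close> completes the square.\<close>

lemma psd_on_schur_complement:
  assumes psd: "psd_on (insert x F) s" and F: "finite F" "x \<notin> F"
  shows "psd_on F (\<lambda>i j. s i j - s i x * s x j / s x x)"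
  unfolding psd_on_def
proof
  fix c :: "'a \<Rightarrow> complex"
  define \<alpha> where "\<alpha> = s x x"
  define t where "t = (\<Sum>j\<in>F. s x j * c j)"
  \<comment> \<open>For a nonzero pivot this entry minimises the form. If the pivot is 0, division
    by zero makes both the entry and the subtracted term vanish, and the step is plain restriction
    to \<open>F\<close>.\<close>
  define c' where "c' = c(x := - t / \<alpha>)"
  have herm: "s i x = cnj (s x i)" if "i \<in> F" for i
    using psd_on_hermitian[OF psd, of x i] F that by simp
  have \<alpha>: "cnj \<alpha> = \<alpha>" unfolding \<alpha>_def
    using psd_on_hermitian[OF psd, of x x] F by auto
  have t': "(\<Sum>i\<in>F. s i x * cnj (c i)) = cnj t"
    unfolding t_def cnj_sum by (rule sum.cong) (auto simp: herm)
  have c': "c' x = - t / \<alpha>" "\<And>i. i \<in> F \<Longrightarrow> c' i = c i"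
    unfolding c'_def using F by auto
  define Q where "Q = (\<Sum>i\<in>F. \<Sum>j\<in>F. s i j * c j * cnj (c i))"
  have "0 \<le> (\<Sum>i\<in>insert x F. \<Sum>j\<in>insert x F. s i j * c' j * cnj (c' i))"
    using psd unfolding psd_on_def by blast
  also have "\<dots> = s x x * c' x * cnj (c' x) + (\<Sum>j\<in>F. s x j * c' j * cnj (c' x))
      + ((\<Sum>i\<in>F. s i x * c' x * cnj (c' i)) + (\<Sum>i\<in>F. \<Sum>j\<in>F. s i j * c' j * cnj (c' i)))"
    using F by (simp add: sum.distrib)
  also have "(\<Sum>j\<in>F. s x j * c' j * cnj (c' x)) = t * cnj (c' x)"
    unfolding t_def sum_distrib_right by (rule sum.cong) (auto simp: c'(2))
  also have "(\<Sum>i\<in>F. s i x * c' x * cnj (c' i)) = c' x * cnj t"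
    unfolding t'[symmetric] sum_distrib_left by (rule sum.cong) (auto simp: c'(2))
  also have "(\<Sum>i\<in>F. \<Sum>j\<in>F. s i j * c' j * cnj (c' i)) = Q"
    unfolding Q_def by (intro sum.cong) (auto simp: c'(2))
  also have "s x x * c' x * cnj (c' x) + t * cnj (c' x) + (c' x * cnj t + Q) = Q - cnj t * t / \<alpha>"
    unfolding c'(1) \<alpha>_def[symmetric] by (cases "\<alpha> = 0") (auto simp: \<alpha> field_simps)
  also have "cnj t * t / \<alpha> = (\<Sum>i\<in>F. \<Sum>j\<in>F. s i x * s x j / \<alpha> * c j * cnj (c i))"
    unfolding t'[symmetric] unfolding t_def sum_product sum_divide_distrib
    by (intro sum.cong) auto
  also have "Q - \<dots> = (\<Sum>i\<in>F. \<Sum>j\<in>F. (s i j - s i x * s x j / s x x) * c j * cnj (c i))"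
    unfolding Q_def \<alpha>_def by (simp add: sum_subtractf algebra_simps)
  finally show "0 \<le> (\<Sum>i\<in>F. \<Sum>j\<in>F. (s i j - s i x * s x j / s x x) * c j * cnj (c i))" .
qed

text \<open>A Cholesky-style elimination: the column of the pivot \<open>x\<close> yields one
  rank-one term, and the Schur complement on the remaining indices is factored by induction.\<close>

lemma psd_on_factorization:
  assumes "finite I" "psd_on I s"
  shows "\<exists>u. \<forall>i\<in>I. \<forall>j\<in>I. s i j = (\<Sum>k\<in>I. u k i * cnj (u k j))"
  using assms
proof (induction I arbitrary: s rule: finite_induct)
  case empty
  then show ?case by simp
next
  case (insert x F)
  obtain u where u: "\<And>i j. i \<in> F \<Longrightarrow> j \<in> F \<Longrightarrow>
      s i j - s i x * s x j / s x x = (\<Sum>k\<in>F. u k i * cnj (u k j))"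
    using insert.IH[OF psd_on_schur_complement[OF insert.prems insert.hyps]] by blast
  have fin: "finite (insert x F)" using insert.hyps by simp
  have herm: "s x i = cnj (s i x)" if "i \<in> insert x F" for i
    using psd_on_hermitian[OF insert.prems fin that, of x] by simp
  have zero: "s i x = 0" if "s x x = 0" "i \<in> insert x F" for i
    using psd_on_zero_diag[OF insert.prems fin that(2)] that(1) by simp
  define r where "r = complex_of_real (sqrt (Re (s x x)))"
  have "0 \<le> s x x" using psd_on_diag[OF insert.prems fin] by simp
  then have r: "r * cnj r = s x x"
    unfolding r_def by (auto simp: less_eq_complex_def complex_eq_iff)
  \<comment> \<open>The new vector is the pivot column divided by the root of the pivot; the
    inductive vectors are extended by 0 at \<open>x\<close>. For a zero pivot the new vector is 0,
    in agreement with \<open>zero\<close>.\<close>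
  define w where "w = (\<lambda>k i. if k = x then s i x / r else if i = x then 0 else u k i)"
  have wx: "w x i * cnj (w x j) = s i x * s x j / s x x" if "j \<in> insert x F" for i j
    unfolding w_def using herm[OF that] r by simp
  have "s i j = (\<Sum>k\<in>insert x F. w k i * cnj (w k j))"
    if ij: "i \<in> insert x F" "j \<in> insert x F" for i j
  proof -
    have "(\<Sum>k\<in>insert x F. w k i * cnj (w k j))
        = s i x * s x j / s x x + (\<Sum>k\<in>F. w k i * cnj (w k j))"
      using insert.hyps wx[OF ij(2)] by simp
    also have "\<dots> = s i j"
    proof (cases "i = x \<or> j = x")
      case True
      then have "(\<Sum>k\<in>F. w k i * cnj (w k j)) = 0"
        unfolding w_def using insert.hyps by (intro sum.neutral) auto
      moreover have "s i x * s x j / s x x = s i j"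
        using True zero[of i] zero[of j] herm[OF ij(2)] ij by (cases "s x x = 0") auto
      ultimately show ?thesis by simp
    next
      case False
      then have "(\<Sum>k\<in>F. w k i * cnj (w k j)) = (\<Sum>k\<in>F. u k i * cnj (u k j))"
        unfolding w_def using insert.hyps by (intro sum.cong) auto
      also have "\<dots> = s i j - s i x * s x j / s x x" using u[of i j] ij False by simp
      finally show ?thesis by simp
    qed
    finally show ?thesis by simp
  qed
  then show ?case by blast
qed

section \<open>Matrix positivity in coordinates and positivity of Kronecker products\<close>

lemma quadratic_form_eq:
  assumes "X \<in> carrier_mat n n" "v \<in> carrier_vec n"
  shows "(X *\<^sub>v v) \<bullet>c v = (\<Sum>i<n. \<Sum>j<n. X $$ (i, j) * v $ j * cnj (v $ i))"
  using assms by (auto simp: scalar_prod_def sum_distrib_right atLeast0LessThan intro!: sum.cong)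

lemma psd_iff_psd_on:
  "psd n X \<longleftrightarrow> X \<in> carrier_mat n n \<and> psd_on {..<n} (\<lambda>i j. X $$ (i, j))"
proof (cases "X \<in> carrier_mat n n")
  case True
  have "(\<forall>v\<in>carrier_vec n. 0 \<le> (X *\<^sub>v v) \<bullet>c v) \<longleftrightarrow> psd_on {..<n} (\<lambda>i j. X $$ (i, j))"
  proof
    assume L: "\<forall>v\<in>carrier_vec n. 0 \<le> (X *\<^sub>v v) \<bullet>c v"
    show "psd_on {..<n} (\<lambda>i j. X $$ (i, j))"
      unfolding psd_on_def
    proof
      fix c :: "nat \<Rightarrow> complex"
      show "0 \<le> (\<Sum>i<n. \<Sum>j<n. X $$ (i, j) * c j * cnj (c i))"
        using bspec[OF L, of "vec n c"] quadratic_form_eq[OF True, of "vec n c"] by simp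
    qed
  next
    assume R: "psd_on {..<n} (\<lambda>i j. X $$ (i, j))"
    show "\<forall>v\<in>carrier_vec n. 0 \<le> (X *\<^sub>v v) \<bullet>c v"
    proof
      fix v :: "complex vec" assume "v \<in> carrier_vec n"
      then show "0 \<le> (X *\<^sub>v v) \<bullet>c v"
        using R quadratic_form_eq[OF True] unfolding psd_on_def by simp
    qed
  qed
  then show ?thesis using True by (simp add: psd_def)
qed (simp add: psd_def)

lemma sum_lessThan_mult:
  "(\<Sum>p<r * d. f p) = (\<Sum>i<r. \<Sum>a<d. f (i * d + a))" for f :: "nat \<Rightarrow> 'a :: comm_monoid_add"
proof -
  have "(\<Sum>p<r * d. f p) = (\<Sum>i<r. sum f {i * d..<i * d + d})"
    by (rule sum.nat_group[symmetric])
  also have "\<dots> = (\<Sum>i<r. \<Sum>a<d. f (i * d + a))"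
  proof (rule sum.cong[OF refl])
    show "sum f {i * d..<i * d + d} = (\<Sum>a<d. f (i * d + a))" for i
      using sum.atLeastLessThan_shift_0[of f "i * d" "i * d + d"] by (simp add: atLeast0LessThan)
  qed
  finally show ?thesis .
qed

lemma index_less:
  fixes i a r d :: nat
  assumes "i < r" "a < d"
  shows "i * d + a < r * d"
proof -
  have "i * d + a < Suc i * d" using assms(2) by simp
  also have "\<dots> \<le> r * d" using assms(1) by (intro mult_le_mono1) simp
  finally show ?thesis .
qed

lemma kron_index:
  assumes "X \<in> carrier_mat r r" "Y \<in> carrier_mat d d" "i < r" "j < r" "a < d" "b < d"
  shows "kron X Y $$ (i * d + a, j * d + b) = X $$ (i, j) * Y $$ (a, b)"
  using assms by (simp add: kron_def index_less)

text \<open>Writing \<open>X\<close> as a sum of rank-one terms \<open>u k\<close> times its adjoint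
  splits the form of \<open>kron X Y\<close> into a sum over \<open>k\<close> of forms of
  \<open>Y\<close>, each nonnegative.\<close>

lemma kron_psd:
  assumes "psd r X" "psd d Y"
  shows "psd (r * d) (kron X Y)"
proof -
  have X: "X \<in> carrier_mat r r" and Y: "Y \<in> carrier_mat d d"
    and Y_pos: "psd_on {..<d} (\<lambda>a b. Y $$ (a, b))"
    using assms by (auto simp: psd_iff_psd_on)
  obtain u where u: "\<And>i j. i < r \<Longrightarrow> j < r \<Longrightarrow> X $$ (i, j) = (\<Sum>k<r. u k i * cnj (u k j))"
    using psd_on_factorization[of "{..<r}" "\<lambda>i j. X $$ (i, j)"] assms(1)
    by (auto simp: psd_iff_psd_on)
  have "0 \<le> (\<Sum>p<r*d. \<Sum>q<r*d. kron X Y $$ (p, q) * c q * cnj (c p))" for c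
  proof -
    \<comment> \<open>The test vector on the composite system, contracted in its first factor
      against the conjugate of \<open>u k\<close>; it is the vector at which \<open>Y\<close> gets
      evaluated.\<close>
    define w where "w = (\<lambda>k b. \<Sum>j<r. cnj (u k j) * c (j * d + b))"
    have "(\<Sum>p<r*d. \<Sum>q<r*d. kron X Y $$ (p, q) * c q * cnj (c p))
        = (\<Sum>i<r. \<Sum>a<d. \<Sum>j<r. \<Sum>b<d.
            (\<Sum>k<r. u k i * cnj (u k j)) * Y $$ (a, b) * c (j * d + b) * cnj (c (i * d + a)))"
      unfolding sum_lessThan_mult
      by (intro sum.cong refl) (simp add: kron_index[OF X Y] u)
    also have "\<dots> = (\<Sum>i<r. \<Sum>a<d. \<Sum>j<r. \<Sum>b<d. \<Sum>k<r.
            u k i * cnj (u k j) * Y $$ (a, b) * c (j * d + b) * cnj (c (i * d + a)))"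
      by (simp add: sum_distrib_right)
    also have "\<dots> = (\<Sum>k<r. \<Sum>a<d. \<Sum>b<d. \<Sum>i<r. \<Sum>j<r.
            u k i * cnj (u k j) * Y $$ (a, b) * c (j * d + b) * cnj (c (i * d + a)))"
    proof -
      \<comment> \<open>Flattening to a single sum over tuples turns the exchange of five sums into
        one bijection.\<close>
      have "(\<Sum>i<r. \<Sum>a<d. \<Sum>j<r. \<Sum>b<d. \<Sum>k<r. F i a j b k)
          = (\<Sum>k<r. \<Sum>a<d. \<Sum>b<d. \<Sum>i<r. \<Sum>j<r. F i a j b k)"
        for F :: "nat \<Rightarrow> nat \<Rightarrow> nat \<Rightarrow> nat \<Rightarrow> nat \<Rightarrow> complex"
      proof -
        have "(\<Sum>i<r. \<Sum>a<d. \<Sum>j<r. \<Sum>b<d. \<Sum>k<r. F i a j b k)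
            = (\<Sum>(i,a,j,b,k)\<in>{..<r}\<times>{..<d}\<times>{..<r}\<times>{..<d}\<times>{..<r}. F i a j b k)"
          by (simp add: sum.cartesian_product)
        also have "\<dots> = (\<Sum>(k,a,b,i,j)\<in>{..<r}\<times>{..<d}\<times>{..<d}\<times>{..<r}\<times>{..<r}. F i a j b k)"
          by (rule sum.reindex_bij_witness[where i="\<lambda>(k,a,b,i,j). (i,a,j,b,k)"
                and j="\<lambda>(i,a,j,b,k). (k,a,b,i,j)"]) auto
        also have "\<dots> = (\<Sum>k<r. \<Sum>a<d. \<Sum>b<d. \<Sum>i<r. \<Sum>j<r. F i a j b k)"
          by (simp add: sum.cartesian_product)
        finally show ?thesis .
      qed
      then show ?thesis .
    qed
    also have "\<dots> = (\<Sum>k<r. \<Sum>a<d. \<Sum>b<d. Y $$ (a, b) * w k b * cnj (w k a))"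
    proof (intro sum.cong refl)
      fix k a b
      have "w k b * cnj (w k a) = (\<Sum>i<r. \<Sum>j<r.
          u k i * cnj (u k j) * c (j * d + b) * cnj (c (i * d + a)))"
        unfolding w_def cnj_sum by (subst mult.commute, subst sum_product, intro sum.cong refl) simp
      then have "Y $$ (a, b) * w k b * cnj (w k a) = Y $$ (a, b) * (\<Sum>i<r. \<Sum>j<r.
          u k i * cnj (u k j) * c (j * d + b) * cnj (c (i * d + a)))"
        by (simp add: mult.assoc)
      then show "(\<Sum>i<r. \<Sum>j<r.
          u k i * cnj (u k j) * Y $$ (a, b) * c (j * d + b) * cnj (c (i * d + a)))
          = Y $$ (a, b) * w k b * cnj (w k a)"
        by (auto simp: sum_distrib_left intro!: sum.cong)
    qed
    also have "0 \<le> \<dots>"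
      using Y_pos unfolding psd_on_def by (intro sum_nonneg[of "{..<r}"]) blast
    finally show ?thesis .
  qed
  moreover have "kron X Y \<in> carrier_mat (r * d) (r * d)"
    using X Y by (auto simp: kron_def)
  ultimately show ?thesis by (simp add: psd_iff_psd_on psd_on_def)
qed

section \<open>Block calculus for tensor products, traces and marginals\<close>

lemma statesD:
  assumes "\<rho> \<in> states n"
  shows "\<rho> \<in> carrier_mat n n" "psd n \<rho>" "mat_trace \<rho> = 1"
  using assms by (auto simp: states_def psd_def)

lemma block_carrier [simp]: "block n X i j \<in> carrier_mat n n"
  by (simp add: block_def)

lemma id_tensor_carrier [simp]: "id_tensor k n m T X \<in> carrier_mat (k * m) (k * m)"
  by (simp add: id_tensor_def)

lemma kron_carrier:
  "X \<in> carrier_mat r r \<Longrightarrow> Y \<in> carrier_mat d d \<Longrightarrow> kron X Y \<in> carrier_mat (r * d) (r * d)"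
  by (auto simp: kron_def)

text \<open>The main device for identities about \<open>id_tensor\<close> and \<open>kron\<close>:
  on blocks these become application of the map and scaling by an entry.\<close>

lemma eq_mat_blockI:
  assumes "X \<in> carrier_mat (k * n) (k * n)" "Y \<in> carrier_mat (k * n) (k * n)"
    and eq: "\<And>i j. i < k \<Longrightarrow> j < k \<Longrightarrow> block n X i j = block n Y i j"
  shows "X = Y"
proof (rule eq_matI)
  fix p q assume "p < dim_row Y" "q < dim_col Y"
  then have pq: "p < k * n" "q < k * n" using assms by auto
  then have "0 < n" by (cases n) auto
  have "p div n < k" "q div n < k" using pq by (simp_all add: less_mult_imp_div_less)
  from arg_cong[OF eq[OF this], of "\<lambda>Z. Z $$ (p mod n, q mod n)"]
  show "X $$ (p, q) = Y $$ (p, q)"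
    using \<open>0 < n\<close> by (simp add: block_def)
qed (use assms in auto)

lemma block_add:
  assumes "X \<in> carrier_mat (k * n) (k * n)" "Y \<in> carrier_mat (k * n) (k * n)" "i < k" "j < k"
  shows "block n (X + Y) i j = block n X i j + block n Y i j"
  using assms by (intro eq_matI) (auto simp: block_def index_less)

lemma block_smult:
  assumes "X \<in> carrier_mat (k * n) (k * n)" "i < k" "j < k"
  shows "block n (c \<cdot>\<^sub>m X) i j = c \<cdot>\<^sub>m block n X i j"
  using assms by (intro eq_matI) (auto simp: block_def index_less)

lemma block_kron:
  assumes "X \<in> carrier_mat r r" "Y \<in> carrier_mat d d" "i < r" "j < r"
  shows "block d (kron X Y) i j = X $$ (i, j) \<cdot>\<^sub>m Y"
  using assms by (intro eq_matI) (auto simp: block_def kron_index)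

lemma block_id_tensor:
  assumes "T \<in> carrier_mat n n \<rightarrow> carrier_mat m m" "i < k" "j < k"
  shows "block m (id_tensor k n m T X) i j = T (block n X i j)"
proof -
  have "T (block n X i j) \<in> carrier_mat m m" using assms(1) block_carrier by blast
  then show ?thesis
    using assms(2,3) by (intro eq_matI) (auto simp: block_def id_tensor_def index_less)
qed

text \<open>The index identity is
  \<open>(i * r + i') * n + a = i * (r * n) + (i' * n + a)\<close>.\<close>

lemma block_block:
  assumes "i' < r" "j' < r"
  shows "block n (block (r * n) X i j) i' j' = block n X (i * r + i') (j * r + j')"
  using assms by (intro eq_matI) (auto simp: block_def index_less add_mult_distrib mult.assoc add.assoc)

lemma mat_trace_blocks:
  assumes "X \<in> carrier_mat (r * d) (r * d)"
  shows "mat_trace X = (\<Sum>i<r. mat_trace (block d X i i))"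
proof -
  have "dim_row X = r * d" using assms by auto
  then show ?thesis by (simp add: mat_trace_def sum_lessThan_mult block_def)
qed

lemma mat_trace_smult: "X \<in> carrier_mat n n \<Longrightarrow> mat_trace (c \<cdot>\<^sub>m X) = c * mat_trace X"
  by (auto simp: mat_trace_def sum_distrib_left)

lemma marginal_eq_trace_block: "marginal r d X = mat r r (\<lambda>(i, j). mat_trace (block d X i j))"
  by (rule eq_matI) (auto simp: marginal_def mat_trace_def block_def)

lemma mat_trace_kron:
  assumes "X \<in> carrier_mat r r" "Y \<in> carrier_mat d d"
  shows "mat_trace (kron X Y) = mat_trace X * mat_trace Y"
proof -
  have "mat_trace (kron X Y) = (\<Sum>i<r. X $$ (i, i) * mat_trace Y)"
    unfolding mat_trace_blocks[OF kron_carrier[OF assms]]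
    by (rule sum.cong) (auto simp: block_kron[OF assms] mat_trace_smult[OF assms(2)])
  moreover have "dim_row X = r" using assms by auto
  ultimately show ?thesis by (simp add: mat_trace_def sum_distrib_right)
qed

lemma marginal_kron:
  assumes "X \<in> carrier_mat r r" "Y \<in> carrier_mat d d" "mat_trace Y = 1"
  shows "marginal r d (kron X Y) = X"
  unfolding marginal_eq_trace_block
  using assms by (intro eq_matI) (auto simp: block_kron mat_trace_smult)

lemma kron_states: "\<sigma> \<in> states r \<Longrightarrow> \<omega> \<in> states d \<Longrightarrow> kron \<sigma> \<omega> \<in> states (r * d)"
  using kron_psd mat_trace_kron[OF statesD(1) statesD(1)] by (auto simp: states_def)

section \<open>Channels, their amplifications and the preparation channel\<close>

lemma channelD:
  assumes "channel n m T"
  shows "T \<in> carrier_mat n n \<rightarrow> carrier_mat m m"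
    and "\<And>X Y. X \<in> carrier_mat n n \<Longrightarrow> Y \<in> carrier_mat n n \<Longrightarrow> T (X + Y) = T X + T Y"
    and "\<And>c X. X \<in> carrier_mat n n \<Longrightarrow> T (c \<cdot>\<^sub>m X) = c \<cdot>\<^sub>m T X"
    and "\<And>k X. psd (k * n) X \<Longrightarrow> psd (k * m) (id_tensor k n m T X)"
    and "\<And>X. X \<in> carrier_mat n n \<Longrightarrow> mat_trace (T X) = mat_trace X"
  using assms unfolding channel_def by blast+

text \<open>Positivity of \<open>T\<close> itself is complete positivity at level
  \<open>k = 1\<close>.\<close>

lemma channel_states:
  assumes "channel n m T" "\<rho> \<in> states n"
  shows "T \<rho> \<in> states m"
proof -
  note T = channelD[OF assms(1)] and \<rho> = statesD[OF assms(2)]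
  have "T \<rho> \<in> carrier_mat m m" using T(1) \<rho>(1) by blast
  moreover have "block n \<rho> 0 0 = \<rho>" using \<rho>(1) by (intro eq_matI) (auto simp: block_def)
  ultimately have "id_tensor 1 n m T \<rho> = T \<rho>" by (intro eq_matI) (auto simp: id_tensor_def)
  then show ?thesis using T(4)[of 1 \<rho>] T(5) \<rho> by (simp add: states_def)
qed

text \<open>Mixed-radix digits: an index of a triple product has the same three digits however the
  factors are grouped.\<close>

lemma div_mod_nested:
  fixes p m r :: nat
  shows "p mod (r * m) mod m = p mod m" "p mod (r * m) div m = p div m mod r"
    "p div (r * m) = p div m div r"
proof -
  show "p mod (r * m) mod m = p mod m" by (simp add: mod_mod_cancel)
  show "p mod (r * m) div m = p div m mod r"
    by (cases "m = 0") (simp_all add: mult.commute[of r] mod_mult2_eq)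
  show "p div (r * m) = p div m div r" by (simp add: mult.commute[of r] div_mult2_eq)
qed

text \<open>Associativity of the tensor product. It reduces complete positivity of
  \<open>id_tensor r n m T\<close> at level \<open>k\<close> to that of \<open>T\<close> at level
  \<open>k * r\<close>.\<close>

lemma id_tensor_id_tensor:
  "id_tensor k (r * n) (r * m) (id_tensor r n m T) X = id_tensor (k * r) n m T X"
proof (rule eq_matI)
  fix p q assume "p < dim_row (id_tensor (k * r) n m T X)" "q < dim_col (id_tensor (k * r) n m T X)"
  then have pq: "p < k * (r * m)" "q < k * (r * m)" by (simp_all add: id_tensor_def mult.assoc)
  then have pos: "0 < r" "0 < m" by (auto intro!: gr0I)
  then show "id_tensor k (r * n) (r * m) (id_tensor r n m T) X $$ (p, q)
      = id_tensor (k * r) n m T X $$ (p, q)"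
    using pq by (simp add: id_tensor_def mult.assoc block_block div_mod_nested)
qed (auto simp: id_tensor_def)

lemma channel_id_tensor:
  assumes "channel n m T"
  shows "channel (r * n) (r * m) (id_tensor r n m T)"
proof -
  note T = channelD[OF assms]
  let ?S = "id_tensor r n m T"
  have T_block: "T (block n X i j) \<in> carrier_mat m m" for X i j
    using T(1) block_carrier by blast
  have "?S (X + Y) = ?S X + ?S Y"
    if "X \<in> carrier_mat (r * n) (r * n)" "Y \<in> carrier_mat (r * n) (r * n)" for X Y
    by (rule eq_mat_blockI[of _ r m])
      (simp_all add: block_id_tensor[OF T(1)] block_add[of _ r] that T(2))
  moreover have "?S (c \<cdot>\<^sub>m X) = c \<cdot>\<^sub>m ?S X" if "X \<in> carrier_mat (r * n) (r * n)" for c X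
    by (rule eq_mat_blockI[of _ r m])
      (simp_all add: block_id_tensor[OF T(1)] block_smult[of _ r] that T(3))
  moreover have "psd (k * (r * m)) (id_tensor k (r * n) (r * m) ?S X)"
    if "psd (k * (r * n)) X" for k X
    using T(4)[of "k * r" X] that by (simp add: id_tensor_id_tensor mult.assoc)
  moreover have "mat_trace (?S X) = mat_trace X" if "X \<in> carrier_mat (r * n) (r * n)" for X
    by (simp add: mat_trace_blocks[of _ r m] mat_trace_blocks[OF that] block_id_tensor[OF T(1)] T(5))
  ultimately show ?thesis by (simp add: channel_def)
qed

text \<open>Amplifying the map that appends \<open>\<omega>\<close> gives the map that appends
  \<open>\<omega>\<close> to the larger system, so complete positivity of the preparation map
  becomes \<open>kron_psd\<close>.\<close>

lemma id_tensor_kron_right: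
  assumes "X \<in> carrier_mat (k * r) (k * r)" "\<omega> \<in> carrier_mat d d"
  shows "id_tensor k r (r * d) (\<lambda>X. kron X \<omega>) X = kron X \<omega>"
proof (rule eq_matI)
  fix p q assume "p < dim_row (kron X \<omega>)" "q < dim_col (kron X \<omega>)"
  then have pq: "p < k * (r * d)" "q < k * (r * d)" using assms by (auto simp: kron_def mult.assoc)
  then have pos: "0 < r" "0 < d" by (auto intro!: gr0I)
  have "p div d < k * r" "q div d < k * r"
    using pq by (simp_all add: less_mult_imp_div_less mult.assoc)
  then show "id_tensor k r (r * d) (\<lambda>X. kron X \<omega>) X $$ (p, q) = kron X \<omega> $$ (p, q)"
    using pq pos assms
    by (auto simp: id_tensor_def kron_def block_def div_mod_nested mult.assoc)
qed (use assms in \<open>auto simp: id_tensor_def kron_def\<close>)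

lemma channel_kron_right:
  assumes "\<omega> \<in> states d"
  shows "channel r (r * d) (\<lambda>X. kron X \<omega>)"
proof -
  note \<omega> = statesD[OF assms]
  have "kron (X + Y) \<omega> = kron X \<omega> + kron Y \<omega>"
    if "X \<in> carrier_mat r r" "Y \<in> carrier_mat r r" for X Y
    by (rule eq_mat_blockI[of _ r d], insert that \<omega>(1))
      (auto simp: block_kron[of _ r] block_add[of _ r] kron_carrier add_carrier_mat add_smult_distrib_right_mat)
  moreover have "kron (c \<cdot>\<^sub>m X) \<omega> = c \<cdot>\<^sub>m kron X \<omega>" if "X \<in> carrier_mat r r" for c X
    by (rule eq_mat_blockI[of _ r d], insert that \<omega>(1))
      (auto simp: block_kron[of _ r] block_smult[of _ r] kron_carrier)
  moreover have "psd (k * (r * d)) (id_tensor k r (r * d) (\<lambda>X. kron X \<omega>) X)"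
    if "psd (k * r) X" for k X
    using kron_psd[OF that \<omega>(2)] that id_tensor_kron_right[of X k r \<omega> d] \<omega>(1)
    by (simp add: psd_def mult.assoc)
  ultimately show ?thesis
    using \<omega> by (auto simp: channel_def kron_carrier mat_trace_kron)
qed

text \<open>Every block is a scalar multiple of \<open>\<omega>\<close>, and \<open>N\<close> is
  homogeneous.\<close>

lemma id_tensor_kron_fixed:
  assumes "channel d d N" "N \<omega> = \<omega>" "\<omega> \<in> carrier_mat d d" "\<sigma> \<in> carrier_mat r r"
  shows "id_tensor r d d N (kron \<sigma> \<omega>) = kron \<sigma> \<omega>"
  by (rule eq_mat_blockI[of _ r d], insert assms)
    (auto simp: kron_carrier block_id_tensor channelD[OF assms(1)] block_kron)

text \<open>Entries of the marginal are traces of blocks, so this is trace preservation block by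
  block.\<close>

lemma marginal_id_tensor:
  assumes "channel n m T"
  shows "marginal r m (id_tensor r n m T X) = marginal r n X"
  unfolding marginal_eq_trace_block
  by (rule eq_matI) (simp_all add: block_id_tensor channelD[OF assms])

text \<open>Turns the amplified power in \<open>replacement_time\<close> into iteration of one
  amplified step, as induction on time requires. The dimension of \<open>X\<close> enters at
  \<open>n = 0\<close>, where \<open>id_tensor\<close> rebuilds a square matrix of size
  \<open>r * d\<close>.\<close>

lemma id_tensor_funpow:
  assumes "N \<in> carrier_mat d d \<rightarrow> carrier_mat d d" "X \<in> carrier_mat (r * d) (r * d)"
  shows "id_tensor r d d (N ^^ n) X = (id_tensor r d d N ^^ n) X"
proof (induction n)
  case 0
  show ?case
    by (rule eq_mat_blockI[of _ r d]) (simp_all add: assms block_id_tensor)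
next
  case (Suc n)
  have pow: "N ^^ k \<in> carrier_mat d d \<rightarrow> carrier_mat d d" for k
    using assms(1) by (induction k) auto
  have "id_tensor r d d (N ^^ Suc n) X = id_tensor r d d N (id_tensor r d d (N ^^ n) X)"
    by (rule eq_mat_blockI[of _ r d])
      (simp_all add: block_id_tensor[OF pow] block_id_tensor[OF pow[of "Suc n", simplified]]
         block_id_tensor[OF assms(1)])
  then show ?case by (simp add: Suc.IH o_def)
qed

section \<open>The divergence gap and its contraction\<close>

lemma divergenceD:
  assumes "divergence D" "channel n m T" "\<rho> \<in> states n" "\<sigma> \<in> states n"
  shows "D (T \<rho>) (T \<sigma>) \<le> D \<rho> \<sigma>"
  using assms unfolding divergence_def by blast

text \<open>The common expression behind \<open>replacement_time\<close>, \<open>C_Delta\<close>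
  and, for the reference state \<open>kron \<sigma> \<omega>\<close>, numerator and denominator of
  \<open>sdpi_ratios\<close>.\<close>

definition divergence_gap ::
    "divergence_fun \<Rightarrow> nat \<Rightarrow> nat \<Rightarrow> complex mat \<Rightarrow> complex mat \<Rightarrow> complex mat \<Rightarrow> ereal" where
  "divergence_gap D r d \<omega> \<rho> \<sigma> = D \<rho> (kron \<sigma> \<omega>) - D (marginal r d \<rho>) \<sigma>"

lemma sdpi_ratio_le_eta:
  assumes "\<rho> \<in> states (s * d)" "\<tau> \<in> states s" "\<rho> \<noteq> kron \<tau> \<omega>"
    and \<omega>: "\<omega> \<in> states d" "N \<omega> = \<omega>" and N: "channel d d N"
    and gap: "0 < divergence_gap D s d \<omega> \<rho> \<tau>" "divergence_gap D s d \<omega> \<rho> \<tau> < \<infinity>"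
  shows "divergence_gap D s d \<omega> (id_tensor s d d N \<rho>) \<tau> / divergence_gap D s d \<omega> \<rho> \<tau>
    \<le> eta_Delta_stab D d N \<omega>"
proof -
  note \<omega>' = statesD[OF \<omega>(1)] and \<tau> = statesD[OF assms(2)]
  have "divergence_gap D s d \<omega> (id_tensor s d d N \<rho>) \<tau> / divergence_gap D s d \<omega> \<rho> \<tau>
      \<in> sdpi_ratios D s d N (kron \<tau> \<omega>)"
    unfolding sdpi_ratios_def marginal_kron[OF \<tau>(1) \<omega>'(1,3)]
      id_tensor_kron_fixed[OF N \<omega>(2) \<omega>'(1) \<tau>(1)]
    using assms(1,3) gap unfolding divergence_gap_def marginal_id_tensor[OF N] by blast
  then have "divergence_gap D s d \<omega> (id_tensor s d d N \<rho>) \<tau> / divergence_gap D s d \<omega> \<rho> \<tau>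
      \<le> eta_Delta D s d N (kron \<tau> \<omega>)"
    \<comment> \<open>The ratio just exhibited shows that the set is nonempty, so
      \<open>eta_Delta\<close> is the supremum and not its default value 0.\<close>
    unfolding eta_Delta_def by (auto intro: Sup_upper)
  also have "\<dots> \<le> eta_Delta_stab D d N \<omega>"
    unfolding eta_Delta_stab_def by (rule Sup_upper) (use assms(2) in blast)
  finally show ?thesis .
qed

text \<open>Data processing bounds each numerator by its denominator. The consequence needed later
  is that the logarithm of \<open>1 / \<eta>\<close> is nonnegative.\<close>

lemma eta_Delta_stab_le_1:
  assumes "divergence D" "channel d d N" "\<omega> \<in> states d"
  shows "eta_Delta_stab D d N \<omega> \<le> 1"
  unfolding eta_Delta_stab_def
proof (rule Sup_least, clarify)
  fix s \<tau> assume \<tau>: "\<tau> \<in> states s"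
  have "x \<le> 1" if "x \<in> sdpi_ratios D s d N (kron \<tau> \<omega>)" for x
  proof -
    \<comment> \<open>The marginal term is abstracted to \<open>c\<close>: all that counts is that
      the same quantity is subtracted above and below.\<close>
    from that obtain \<rho> c where \<rho>: "\<rho> \<in> states (s * d)"
      and pos: "0 < D \<rho> (kron \<tau> \<omega>) - c" "D \<rho> (kron \<tau> \<omega>) - c < \<infinity>"
      and x: "x = (D (id_tensor s d d N \<rho>) (id_tensor s d d N (kron \<tau> \<omega>)) - c)
        / (D \<rho> (kron \<tau> \<omega>) - c)"
      unfolding sdpi_ratios_def by blast
    have "D (id_tensor s d d N \<rho>) (id_tensor s d d N (kron \<tau> \<omega>)) \<le> D \<rho> (kron \<tau> \<omega>)"
      using assms \<rho> \<tau> by (intro divergenceD[OF assms(1) channel_id_tensor] kron_states)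
    then have "D (id_tensor s d d N \<rho>) (id_tensor s d d N (kron \<tau> \<omega>)) - c
        \<le> D \<rho> (kron \<tau> \<omega>) - c"
      by (intro ereal_minus_mono) auto
    then show ?thesis unfolding x using pos by (subst ereal_divide_le_pos) auto
  qed
  then show "eta_Delta D s d N (kron \<tau> \<omega>) \<le> 1"
    unfolding eta_Delta_def by (auto intro: Sup_least)
qed

text \<open>A nonnegative bound \<open>c\<close> takes the place of the gap itself, because
  multiplying a negative gap by \<open>e < 1\<close> would raise it, and data processing alone does
  not give a smaller value. A real \<open>c\<close> also keeps the gap below
  \<open>\<infinity>\<close>.\<close>

lemma divergence_gap_id_tensor_le:
  assumes D: "divergence D" and N: "channel d d N" and \<omega>: "\<omega> \<in> states d" "N \<omega> = \<omega>"
    and \<rho>: "\<rho> \<in> states (r * d)" and \<sigma>: "\<sigma> \<in> states r"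
    and gap: "divergence_gap D r d \<omega> \<rho> \<sigma> \<le> ereal c" and c: "0 \<le> c"
    and \<eta>: "eta_Delta_stab D d N \<omega> = ereal e" "0 \<le> e"
  shows "divergence_gap D r d \<omega> (id_tensor r d d N \<rho>) \<sigma> \<le> ereal (e * c)"
proof (cases "divergence_gap D r d \<omega> \<rho> \<sigma> \<le> 0")
  case True
  have "D (id_tensor r d d N \<rho>) (id_tensor r d d N (kron \<sigma> \<omega>)) \<le> D \<rho> (kron \<sigma> \<omega>)"
    by (rule divergenceD[OF D channel_id_tensor[OF N] \<rho> kron_states[OF \<sigma> \<omega>(1)]])
  then have "divergence_gap D r d \<omega> (id_tensor r d d N \<rho>) \<sigma> \<le> divergence_gap D r d \<omega> \<rho> \<sigma>"
    unfolding divergence_gap_def marginal_id_tensor[OF N]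
      id_tensor_kron_fixed[OF N \<omega>(2) statesD(1)[OF \<omega>(1)] statesD(1)[OF \<sigma>]]
    by (intro ereal_minus_mono) auto
  also note True
  also have "(0 :: ereal) \<le> ereal (e * c)" using \<eta> c by simp
  finally show ?thesis .
next
  case False
  then have pos: "0 < divergence_gap D r d \<omega> \<rho> \<sigma>" by simp
  have fin: "divergence_gap D r d \<omega> \<rho> \<sigma> < \<infinity>" using gap by auto
  have "\<rho> \<noteq> kron \<sigma> \<omega>"
  proof
    assume eq: "\<rho> = kron \<sigma> \<omega>"
    have "D (kron \<sigma> \<omega>) (kron \<sigma> \<omega>) \<le> D \<sigma> \<sigma>"
      by (rule divergenceD[OF D channel_kron_right[OF \<omega>(1)] \<sigma> \<sigma>])
    \<comment> \<open>Finiteness of the gap rules out a difference of equal infinities, which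
      \<open>ereal\<close> evaluates to \<open>\<infinity>\<close>; otherwise the inequality
      contradicts positivity of the gap.\<close>
    then show False
      using pos fin unfolding divergence_gap_def eq
        marginal_kron[OF statesD(1)[OF \<sigma>] statesD(1,3)[OF \<omega>(1)]]
      by (cases "D (kron \<sigma> \<omega>) (kron \<sigma> \<omega>)"; cases "D \<sigma> \<sigma>") auto
  qed
  from sdpi_ratio_le_eta[OF \<rho> \<sigma> this \<omega> N pos fin]
  have "divergence_gap D r d \<omega> (id_tensor r d d N \<rho>) \<sigma>
      \<le> divergence_gap D r d \<omega> \<rho> \<sigma> * ereal e"
    unfolding \<eta>(1) using pos fin by (subst (asm) ereal_divide_le_pos) auto
  also have "\<dots> \<le> ereal c * ereal e"
    by (rule ereal_mult_right_mono) (use gap \<eta> in auto)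
  finally show ?thesis by (simp add: mult.commute)
qed

lemma divergence_gap_iterate_le:
  assumes D: "divergence D" and N: "channel d d N" and \<omega>: "\<omega> \<in> states d" "N \<omega> = \<omega>"
    and \<rho>: "\<rho> \<in> states (r * d)" and \<sigma>: "\<sigma> \<in> states r"
    and gap: "divergence_gap D r d \<omega> \<rho> \<sigma> \<le> ereal c" and c: "0 \<le> c"
    and \<eta>: "eta_Delta_stab D d N \<omega> = ereal e" "0 \<le> e"
  shows "divergence_gap D r d \<omega> (id_tensor r d d (N ^^ n) \<rho>) \<sigma> \<le> ereal (e ^ n * c)"
proof -
  let ?M = "id_tensor r d d N"
  have st: "(?M ^^ n) \<rho> \<in> states (r * d)" for n
    by (induction n) (auto simp: \<rho> intro: channel_states[OF channel_id_tensor[OF N]])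
  have "divergence_gap D r d \<omega> ((?M ^^ n) \<rho>) \<sigma> \<le> ereal (e ^ n * c)"
  proof (induction n)
    case 0
    then show ?case using gap by simp
  next
    case (Suc n)
    have "divergence_gap D r d \<omega> (?M ((?M ^^ n) \<rho>)) \<sigma> \<le> ereal (e * (e ^ n * c))"
      by (rule divergence_gap_id_tensor_le[OF D N \<omega> st \<sigma> Suc.IH _ \<eta>]) (use c \<eta> in simp)
    then show ?case by (simp add: mult.assoc)
  qed
  then show ?thesis
    using id_tensor_funpow[OF channelD(1)[OF N] statesD(1)[OF \<rho>]] by simp
qed

lemma marginal_id_tensor_funpow:
  assumes "channel d d N" "X \<in> carrier_mat (r * d) (r * d)"
  shows "marginal r d (id_tensor r d d (N ^^ n) X) = marginal r d X"
  unfolding id_tensor_funpow[OF channelD(1)[OF assms(1)] assms(2)]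
  by (induction n) (simp_all add: marginal_id_tensor[OF assms(1)])

section \<open>Upper bounds on the replacement time\<close>

lemma replacement_time_le:
  assumes "unique_fixed_state d N \<omega>"
    and "\<And>r \<rho> \<sigma>. \<rho> \<in> states (r * d) \<Longrightarrow> \<sigma> \<in> states r \<Longrightarrow> D (marginal r d \<rho>) \<sigma> \<noteq> \<infinity> \<Longrightarrow>
      D (id_tensor r d d (N ^^ n) \<rho>) (kron \<sigma> \<omega>) - D (marginal r d \<rho>) \<sigma> \<le> ereal \<delta>"
  shows "replacement_time D d N \<delta> \<le> ereal (real n)"
proof -
  have "(THE \<omega>. unique_fixed_state d N \<omega>) = \<omega>"
    using assms(1) by (intro the_equality) (auto simp: unique_fixed_state_def)
  then show ?thesis
    unfolding replacement_time_def Let_def using assms(2) by (intro INF_lower) auto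
qed

lemma divergence_gap_le_C_Delta:
  assumes "\<rho> \<in> states (r * d)" "\<sigma> \<in> states r" "D (marginal r d \<rho>) \<sigma> \<noteq> \<infinity>"
  shows "divergence_gap D r d \<omega> \<rho> \<sigma> \<le> C_Delta D d \<omega>"
  unfolding C_Delta_def divergence_gap_def by (rule Sup_upper) (use assms in blast)

lemma replacement_time_le_0:
  assumes "channel d d N" "unique_fixed_state d N \<omega>" "C_Delta D d \<omega> \<le> ereal \<delta>"
  shows "replacement_time D d N \<delta> \<le> 0"
proof -
  have "replacement_time D d N \<delta> \<le> ereal (real 0)"
  proof (rule replacement_time_le[OF assms(2)])
    fix r \<rho> \<sigma>
    assume *: "\<rho> \<in> states (r * d)" "\<sigma> \<in> states r" "D (marginal r d \<rho>) \<sigma> \<noteq> \<infinity>"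
    have "id_tensor r d d (N ^^ 0) \<rho> = \<rho>"
      using id_tensor_funpow[OF channelD(1)[OF assms(1)] statesD(1)[OF *(1)], of 0] by simp
    then show "D (id_tensor r d d (N ^^ 0) \<rho>) (kron \<sigma> \<omega>) - D (marginal r d \<rho>) \<sigma> \<le> ereal \<delta>"
      using order_trans[OF divergence_gap_le_C_Delta[where D = D and \<omega> = \<omega>, OF *] assms(3)]
      by (simp only: divergence_gap_def)
  qed
  then show ?thesis by (simp add: zero_ereal_def)
qed

text \<open>All initial gaps in question are at most \<open>c\<close>, and \<open>n\<close> steps
  shrink this bound to \<open>e ^ n * c\<close>. The value \<open>e = 0\<close> is included and
  serves the one-step bound.\<close>

lemma replacement_time_le_power:
  assumes D: "divergence D" and N: "channel d d N" and fixed: "unique_fixed_state d N \<omega>"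
    and C: "C_Delta D d \<omega> = ereal c" "0 \<le> c"
    and \<eta>: "eta_Delta_stab D d N \<omega> = ereal e" "0 \<le> e"
    and n: "e ^ n * c \<le> \<delta>"
  shows "replacement_time D d N \<delta> \<le> ereal (real n)"
proof (rule replacement_time_le[OF fixed])
  fix r \<rho> \<sigma>
  assume *: "\<rho> \<in> states (r * d)" "\<sigma> \<in> states r" "D (marginal r d \<rho>) \<sigma> \<noteq> \<infinity>"
  have \<omega>: "\<omega> \<in> states d" "N \<omega> = \<omega>" using fixed by (auto simp: unique_fixed_state_def)
  have "divergence_gap D r d \<omega> (id_tensor r d d (N ^^ n) \<rho>) \<sigma> \<le> ereal (e ^ n * c)"
    using divergence_gap_le_C_Delta[where D = D and \<omega> = \<omega>, OF *] C
    by (intro divergence_gap_iterate_le[OF D N \<omega> *(1,2) _ _ \<eta>]) auto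
  also have "\<dots> \<le> ereal \<delta>" using n by simp
  finally show "D (id_tensor r d d (N ^^ n) \<rho>) (kron \<sigma> \<omega>) - D (marginal r d \<rho>) \<sigma> \<le> ereal \<delta>"
    unfolding divergence_gap_def marginal_id_tensor_funpow[OF N statesD(1)[OF *(1)]] .
qed

section \<open>Passing to logarithms and the final case distinction\<close>

lemma nat_ceiling_ereal_nonneg: "0 \<le> nat_ceiling_ereal x"
  unfolding nat_ceiling_ereal_def by (rule INF_greatest) simp

text \<open>The infimum is over the empty set. When \<open>C_Delta\<close> exceeds
  \<open>\<delta>\<close>, the cases \<open>C_Delta = \<infinity>\<close>,
  \<open>\<delta> = 0\<close> and \<open>\<eta> = 1\<close> end here.\<close>

lemma nat_ceiling_ereal_PInfty: "nat_ceiling_ereal \<infinity> = \<infinity>"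
  by (simp add: nat_ceiling_ereal_def top_ereal_def)

lemma power_mult_le_of_ln_le:
  fixes e c \<delta> :: real
  assumes "0 < e" "0 < c" "0 < \<delta>" "ln (c / \<delta>) \<le> real n * ln (1 / e)"
  shows "e ^ n * c \<le> \<delta>"
proof -
  have "ln (c / \<delta>) \<le> ln ((1 / e) ^ n)" using assms by (simp add: ln_realpow)
  then have "c / \<delta> \<le> (1 / e) ^ n" using assms by (subst (asm) ln_le_cancel_iff) auto
  then show ?thesis using assms by (simp add: field_simps power_one_over)
qed

text \<open>Time is discrete, hence the rounding up. For \<open>\<eta> = 0\<close> the quotient
  would evaluate to 0, although a gap above \<open>\<delta>\<close> forces at least one step; this
  case is therefore stated separately. Finiteness of \<open>C_Delta\<close> is asked for there
  because SDPI ratios do not control infinite gaps.\<close>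

theorem mainTheorem17:
  fixes D :: "complex mat \<Rightarrow> complex mat \<Rightarrow> ereal"
    and N :: "complex mat \<Rightarrow> complex mat"
    and \<omega> :: "complex mat"
    and d :: nat
    and \<delta> :: real
  assumes "divergence D"
    and "channel d d N"
    and "unique_fixed_state d N \<omega>"
    and "0 \<le> \<delta>"
  shows "(0 < eta_Delta_stab D d N \<omega> \<longrightarrow>
            replacement_time D d N \<delta>
              \<le> nat_ceiling_ereal
                  (ln_ereal (C_Delta D d \<omega> / ereal \<delta>) / ln_ereal (1 / eta_Delta_stab D d N \<omega>))) \<and>
         (eta_Delta_stab D d N \<omega> = 0 \<and> C_Delta D d \<omega> < \<infinity> \<longrightarrow>
            replacement_time D d N \<delta> \<le> (if C_Delta D d \<omega> \<le> ereal \<delta> then 0 else 1))"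
proof (cases "C_Delta D d \<omega> \<le> ereal \<delta>")
  case True
  \<comment> \<open>Time 0 already suffices, and the rounded quotient is nonnegative whatever values
    the logarithms take.\<close>
  then show ?thesis
    using replacement_time_le_0[OF assms(2,3) True] nat_ceiling_ereal_nonneg order_trans by auto
next
  case False
  note C_gt = this[unfolded not_le]
  note rt_le = replacement_time_le_power[OF assms(1-3)]
  define L where "L = ln_ereal (C_Delta D d \<omega> / ereal \<delta>)"
  show ?thesis
  proof (intro conjI impI)
    assume pos: "0 < eta_Delta_stab D d N \<omega>"
    have "eta_Delta_stab D d N \<omega> \<le> 1"
      using eta_Delta_stab_le_1[OF assms(1,2)] assms(3) by (auto simp: unique_fixed_state_def)
    then obtain e where e: "eta_Delta_stab D d N \<omega> = ereal e" "0 < e" "e \<le> 1"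
      using pos by (cases "eta_Delta_stab D d N \<omega>") auto
    have M: "ln_ereal (1 / eta_Delta_stab D d N \<omega>) = ereal (ln (1 / e))"
      using e by (simp add: ln_ereal_def one_ereal_def)
    have M_nonneg: "0 \<le> ln (1 / e)" using e by simp
    show "replacement_time D d N \<delta> \<le> nat_ceiling_ereal
        (ln_ereal (C_Delta D d \<omega> / ereal \<delta>) / ln_ereal (1 / eta_Delta_stab D d N \<omega>))"
      unfolding M L_def[symmetric]
    proof (cases "C_Delta D d \<omega> = \<infinity> \<or> \<delta> = 0")
      case True
      \<comment> \<open>For \<open>\<delta> = 0\<close> this is division of a positive number by
        zero, which is \<open>\<infinity>\<close> in \<open>ereal\<close>; the claimed bound is then
        trivial.\<close>
      have "C_Delta D d \<omega> / ereal \<delta> = \<infinity>"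
        using True C_gt assms(4) by (cases "C_Delta D d \<omega>"; cases "\<delta> = 0") (auto simp: divide_ereal_def)
      then have "L = \<infinity>" by (simp add: L_def ln_ereal_def)
      then have "L / ereal (ln (1 / e)) = \<infinity>"
        using M_nonneg by (cases "ln (1 / e) = 0") (auto simp: divide_ereal_def)
      then show "replacement_time D d N \<delta> \<le> nat_ceiling_ereal (L / ereal (ln (1 / e)))"
        by (simp add: nat_ceiling_ereal_PInfty)
    next
      case False
      then obtain c where c: "C_Delta D d \<omega> = ereal c" "\<delta> < c" and \<delta>: "0 < \<delta>"
        using C_gt assms(4) by (cases "C_Delta D d \<omega>") auto
      have "0 < c" "1 < c / \<delta>" using c \<delta> by simp_all
      then have "\<not> c / \<delta> \<le> 0" and L_pos: "0 < ln (c / \<delta>)" by auto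
      then have L: "L = ereal (ln (c / \<delta>))" using c \<delta> by (simp add: L_def ln_ereal_def)
      show "replacement_time D d N \<delta> \<le> nat_ceiling_ereal (L / ereal (ln (1 / e)))"
      proof (cases "ln (1 / e) = 0")
        case True
        \<comment> \<open>Here \<open>\<eta> = 1\<close>: a positive logarithm is divided by zero,
          and the bound is again \<open>\<infinity>\<close>.\<close>
        then have "L / ereal (ln (1 / e)) = \<infinity>" using L_pos by (simp add: L divide_ereal_def)
        then show ?thesis by (simp add: nat_ceiling_ereal_PInfty)
      next
        case False
        then have M_pos: "0 < ln (1 / e)" using M_nonneg by simp
        show ?thesis
          unfolding nat_ceiling_ereal_def L
        \<comment> \<open>Every natural number at or above the quotient is shown to bound the
          replacement time, so no explicit ceiling has to be computed.\<close>
        proof (rule INF_greatest)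
          fix n assume "n \<in> {n. ereal (ln (c / \<delta>)) / ereal (ln (1 / e)) \<le> ereal (real n)}"
          then have "ln (c / \<delta>) / ln (1 / e) \<le> real n" using M_pos by simp
          then have "ln (c / \<delta>) \<le> real n * ln (1 / e)"
            using M_pos by (simp only: pos_divide_le_eq)
          then have "e ^ n * c \<le> \<delta>"
            using e c \<delta> by (intro power_mult_le_of_ln_le) auto
          then show "replacement_time D d N \<delta> \<le> ereal (real n)"
            using c \<delta> e by (intro rt_le[OF c(1) _ e(1)]) auto
        qed
      qed
    qed
  next
    assume \<eta>: "eta_Delta_stab D d N \<omega> = 0 \<and> C_Delta D d \<omega> < \<infinity>"
    then obtain c where c: "C_Delta D d \<omega> = ereal c" "\<delta> < c"
      using C_gt by (cases "C_Delta D d \<omega>") auto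
    \<comment> \<open>One step is taken since \<open>0 ^ 1 * c = 0\<close>, whereas
      \<open>0 ^ 0 = 1\<close> gives no contraction at time 0.\<close>
    have "replacement_time D d N \<delta> \<le> ereal (real 1)"
      using \<eta> c assms(4) by (intro rt_le[OF c(1), of 0]) (auto simp: zero_ereal_def)
    then show "replacement_time D d N \<delta> \<le> (if C_Delta D d \<omega> \<le> ereal \<delta> then 0 else 1)"
      using False by (simp add: one_ereal_def)
  qed
qed

end
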